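(* For every positive integer $p$ there is a constant $C_p$, depending only on $p$, such that for all integers $n>p$, $$\frac{\Gamma(p/2)}{\sqrt{\pi}\,\Gamma((p+1)/2)}\;\le\;\frac{\mathcal{E}_{n,p}}{n}\;\le\;\frac{\Gamma(p/2)}{\sqrt{\pi}\,\Gamma((p+1)/2)}+C_p\,n^{-1/p}.$$
   Context: $S^{p-1}=\{v\in\mathbb{R}^p:\|v\|=1\}$ with the Euclidean norm. For $\underline{u}=(u_1,\dots,u_n)\in(S^{p-1})^n$ the energy is $E_{n,p}(\underline{u})=\max_{v\in S^{p-1}}\sum_{i=1}^n|u_i\cdot v|$, and the minimal energy is $\mathcal{E}_{n,p}=\min_{\underline{u}\in(S^{p-1})^n}E_{n,p}(\underline{u})$. $\Gamma$ is the Gamma function. *)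

theory Defs
  imports "HOL-Analysis.Analysis"
begin

(* A configuration (u_1,...,u_n) of n points on the sphere is a function on nat, of which
   only the values at indices below n matter. *)

definition energy :: "nat \<Rightarrow> (nat \<Rightarrow> real ^ 'p) \<Rightarrow> real" where
  "energy n u = (SUP v \<in> sphere 0 1. \<Sum>i<n. \<bar>u i \<bullet> v\<bar>)"

definition min_energy :: "nat \<Rightarrow> 'p::finite itself \<Rightarrow> real" where
  "min_energy n _ =
     (INF u \<in> {..<n} \<rightarrow> sphere 0 1. energy n (u :: nat \<Rightarrow> real ^ 'p))"

(* The supremum and the infimum above are a maximum and a minimum. *)

lemma unit_sphere_nonempty: "sphere (0 :: real ^ 'p) 1 \<noteq> {}"
  by simp

lemma energy_attained:
  fixes u :: "nat \<Rightarrow> real ^ 'p"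
  obtains v where "v \<in> sphere 0 1" "energy n u = (\<Sum>i<n. \<bar>u i \<bullet> v\<bar>)"
    "\<And>w. w \<in> sphere 0 1 \<Longrightarrow> (\<Sum>i<n. \<bar>u i \<bullet> w\<bar>) \<le> energy n u"
proof -
  have "\<exists>v\<in>sphere (0 :: real ^ 'p) 1. \<forall>w\<in>sphere 0 1.
      (\<Sum>i<n. \<bar>u i \<bullet> w\<bar>) \<le> (\<Sum>i<n. \<bar>u i \<bullet> v\<bar>)"
    by (intro continuous_attains_sup compact_sphere unit_sphere_nonempty continuous_intros)
  then obtain v where v: "v \<in> sphere (0 :: real ^ 'p) 1"
    and max: "\<And>w. w \<in> sphere 0 1 \<Longrightarrow> (\<Sum>i<n. \<bar>u i \<bullet> w\<bar>) \<le> (\<Sum>i<n. \<bar>u i \<bullet> v\<bar>)"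
    by blast
  have "energy n u = (\<Sum>i<n. \<bar>u i \<bullet> v\<bar>)"
    unfolding energy_def using v max by (intro cSup_eq_maximum) auto
  with v max that show ?thesis by auto
qed

lemma energy_le_add:
  fixes u u' :: "nat \<Rightarrow> real ^ 'p"
  shows "energy n u \<le> energy n u' + (\<Sum>i<n. norm (u i - u' i))"
proof -
  obtain v where v: "v \<in> sphere 0 1" "energy n u = (\<Sum>i<n. \<bar>u i \<bullet> v\<bar>)"
    using energy_attained by metis
  have "\<bar>u i \<bullet> v\<bar> \<le> \<bar>u' i \<bullet> v\<bar> + norm (u i - u' i)" for i
  proof -
    have "\<bar>(u i - u' i) \<bullet> v\<bar> \<le> norm (u i - u' i)"
      using Cauchy_Schwarz_ineq2[of "u i - u' i" v] v(1) by simp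
    then show ?thesis by (simp add: inner_diff_left)
  qed
  then have "energy n u \<le> (\<Sum>i<n. \<bar>u' i \<bullet> v\<bar>) + (\<Sum>i<n. norm (u i - u' i))"
    unfolding v(2) sum.distrib[symmetric] by (intro sum_mono)
  also have "(\<Sum>i<n. \<bar>u' i \<bullet> v\<bar>) \<le> energy n u'"
    using energy_attained v(1) by metis
  finally show ?thesis by simp
qed

lemma min_energy_attained:
  obtains u :: "nat \<Rightarrow> real ^ 'p" where "u \<in> {..<n} \<rightarrow> sphere 0 1"
    "energy n u = min_energy n TYPE('p)"
    "\<And>w :: nat \<Rightarrow> real ^ 'p. w \<in> {..<n} \<rightarrow> sphere 0 1 \<Longrightarrow> min_energy n TYPE('p) \<le> energy n w"
proof -
  let ?K = "UNIV \<rightarrow>\<^sub>E sphere 0 1 :: (nat \<Rightarrow> real ^ 'p) set"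
  have "compactin (product_topology (\<lambda>_. euclidean) UNIV) ?K"
    by (subst compactin_PiE) auto
  then have comp: "compact ?K"
    by (simp add: euclidean_product_topology)
  have ne: "?K \<noteq> {}"
    by (simp add: PiE_eq_empty_iff)
  have cont: "continuous_on ?K (energy n)"
    unfolding continuous_on_def
  proof
    fix u0 :: "nat \<Rightarrow> real ^ 'p"
    assume u0: "u0 \<in> ?K"
    have "((\<lambda>u. u i) \<longlongrightarrow> u0 i) (at u0 within ?K)" for i
      using continuous_on_subset[OF continuous_on_product_coordinates subset_UNIV, of ?K i] u0
      by (simp add: continuous_on_def)
    then have "((\<lambda>u. \<Sum>i<n. norm (u i - u0 i)) \<longlongrightarrow> (\<Sum>i<n. norm (u0 i - u0 i)))
        (at u0 within ?K)"
      by (intro tendsto_intros)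
    then have lim: "((\<lambda>u. \<Sum>i<n. norm (u i - u0 i)) \<longlongrightarrow> 0) (at u0 within ?K)"
      by simp
    have "norm (energy n u - energy n u0) \<le> (\<Sum>i<n. norm (u i - u0 i))" for u
      using energy_le_add[of n u u0] energy_le_add[of n u0 u]
      by (simp add: norm_minus_commute abs_le_iff)
    then have "((\<lambda>u. energy n u - energy n u0) \<longlongrightarrow> 0) (at u0 within ?K)"
      by (intro Lim_null_comparison[OF _ lim]) auto
    then show "(energy n \<longlongrightarrow> energy n u0) (at u0 within ?K)"
      by (simp add: Lim_null[of "energy n"])
  qed
  obtain u where u: "u \<in> ?K" "\<And>w. w \<in> ?K \<Longrightarrow> energy n u \<le> energy n w"
    using continuous_attains_inf[OF comp ne cont] by blast
  have le: "energy n u \<le> energy n w" if "w \<in> {..<n} \<rightarrow> sphere 0 1" for w :: "nat \<Rightarrow> real ^ 'p"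
  proof -
    have "energy n w = energy n (\<lambda>i. if i < n then w i else u i)"
      by (simp add: energy_def)
    moreover have "(\<lambda>i. if i < n then w i else u i) \<in> ?K"
      using that u(1) by (auto simp: PiE_iff Pi_iff)
    ultimately show ?thesis using u(2) by simp
  qed
  have mem: "u \<in> {..<n} \<rightarrow> sphere 0 1"
    using u(1) by (auto simp: PiE_iff)
  have "min_energy n TYPE('p) = energy n u"
    unfolding min_energy_def using mem le by (intro cInf_eq_minimum) auto
  with mem le that show ?thesis by auto
qed

end

theory Submission
  imports Defs
begin

text \<open>
  Let \<open>m\<close> be the constant of the theorem, \<open>mean_abs_proj\<close> below. It is the mean of \<open>\<bar>u \<bullet> v\<bar>\<close>
  over the directions \<open>u\<close>, for any unit vector \<open>v\<close>.

  Directions are averaged by integrating functions of \<open>sgn x\<close>, the unit vector in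
  the direction of \<open>x\<close>, over balls and spherical shells centred at 0; this avoids surface measure
  and polar coordinates. The integral of \<open>\<bar>sgn x \<bullet> v\<bar>\<close> is found from that of \<open>\<bar>x \<bullet> v\<bar>\<close> by a
  homogeneity argument (\<open>nn_integral_ball_norm_homogeneous\<close>); the latter reduces by rotation to
  the integral of a coordinate, which slicing the ball computes (\<open>nn_integral_ball_abs_inner\<close>).

  Lower bound: the energy of a configuration is the maximum over \<open>v\<close> of a sum whose mean over \<open>v\<close>
  is \<open>n * m\<close> (\<open>mean_abs_proj_le_energy\<close>).

  Upper bound: let \<open>V\<close> be the volume of the shell between the radii 1 and 2. Cut space into cubes of
  volume \<open>V / n\<close>, whose side is a constant times \<open>n powr (- 1 / p)\<close>, and take the
  directions of one corner of each cube inside the shell. The sum of \<open>\<bar>u \<bullet> v\<bar>\<close> over these directions,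
  times the volume of a cube, is a Riemann sum for an integral that equals \<open>m * V\<close> for all \<open>v\<close>.
  Since \<open>sgn\<close> is Lipschitz on the shell, its error is of the order of the side of the cubes,
  uniformly in \<open>v\<close> (\<open>sum_inner_cubes_le\<close>). The cubes
  fill the shell except for a neighbourhood of its boundary (\<open>card_inner_cubes_shell_ge\<close>), so
  their number is at most \<open>n\<close> and falls short of \<open>n\<close> by a fraction of the same order; arbitrary unit
  vectors make up the difference.
\<close>

section \<open>Transformations of Lebesgue measure\<close>

lemma cball_measurable [measurable]: "cball (a :: 'a::euclidean_space) r \<in> sets borel"
  by simp

lemma nn_integral_lborel_translation:
  fixes f :: "'a::euclidean_space \<Rightarrow> ennreal"
  assumes [measurable]: "f \<in> borel_measurable borel"
  shows "(\<integral>\<^sup>+x. f (a + x) \<partial>lborel) = (\<integral>\<^sup>+x. f x \<partial>lborel)"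
proof -
  have "(\<integral>\<^sup>+x. f x \<partial>lborel) = (\<integral>\<^sup>+x. f x \<partial>distr lborel borel ((+) a))"
    by (simp only: lborel_distr_plus)
  also have "\<dots> = (\<integral>\<^sup>+x. f (a + x) \<partial>lborel)"
    by (subst nn_integral_distr) auto
  finally show ?thesis by simp
qed

lemma nn_integral_lborel_scaling:
  fixes f :: "'a::euclidean_space \<Rightarrow> ennreal"
  assumes [measurable]: "f \<in> borel_measurable borel" and "c \<noteq> 0"
  shows "(\<integral>\<^sup>+x. f x \<partial>lborel) = ennreal (\<bar>c\<bar> ^ DIM('a)) * (\<integral>\<^sup>+x. f (c *\<^sub>R x) \<partial>lborel)"
  by (subst lborel_affine[OF \<open>c \<noteq> 0\<close>, of 0])
     (simp add: nn_integral_density nn_integral_distr nn_integral_cmult)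

lemma nn_integral_lborel_reflection:
  fixes f :: "'a::euclidean_space \<Rightarrow> ennreal"
  assumes [measurable]: "f \<in> borel_measurable borel"
  shows "(\<integral>\<^sup>+x. f (a - x) \<partial>lborel) = (\<integral>\<^sup>+x. f x \<partial>lborel)"
  using nn_integral_lborel_scaling[of "\<lambda>x. f (a + x)" "-1"] nn_integral_lborel_translation[of f a]
  by simp

text \<open>Fubini's theorem is used as in the proof that a translation-invariant measure is unique up to
  a factor. With \<open>B\<close> the unit ball, translation invariance in either variable turns the double
  integral of \<open>f (T x + y)\<close> over all \<open>x\<close> and over \<open>y\<close> in \<open>B\<close> into
  the product of the volume of \<open>B\<close> with the left-hand side, or with the right-hand side:
  the latter because \<open>B\<close> is invariant under \<open>T\<close>. The volume of \<open>B\<close> then cancels.\<close>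

lemma nn_integral_lborel_orthogonal_transformation:
  fixes f :: "'a::euclidean_space \<Rightarrow> ennreal" and T :: "'a \<Rightarrow> 'a"
  assumes T: "orthogonal_transformation T" and [measurable]: "f \<in> borel_measurable borel"
  shows "(\<integral>\<^sup>+x. f (T x) \<partial>lborel) = (\<integral>\<^sup>+x. f x \<partial>lborel)"
proof -
  let ?B = "cball 0 1 :: 'a set"
  let ?V = "emeasure lborel ?B"
  have lin: "linear T"
    using T by (rule orthogonal_transformation_linear)
  have [measurable]: "T \<in> borel_measurable borel"
    using lin by (intro borel_measurable_continuous_onI linear_continuous_on) (simp add: linear_linear)
  have T_inv: "T (inv T y) = y" for y
    using orthogonal_transformation_surj[OF T] by (simp add: surj_f_inv_f)
  have norm_T: "norm (T x) = norm x" for x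
    using T by (rule orthogonal_transformation_norm)
  have "(\<integral>\<^sup>+x. f (T x) \<partial>lborel) * ?V = (\<integral>\<^sup>+y. (\<integral>\<^sup>+x. f (T x) \<partial>lborel) * indicator ?B y \<partial>lborel)"
    by (simp add: nn_integral_cmult_indicator)
  also have "\<dots> = (\<integral>\<^sup>+y. (\<integral>\<^sup>+x. f (T x + y) * indicator ?B y \<partial>lborel) \<partial>lborel)"
  proof (rule nn_integral_cong)
    fix y :: 'a
    have "(\<integral>\<^sup>+x. f (T x) \<partial>lborel) = (\<integral>\<^sup>+x. f (T (inv T y + x)) \<partial>lborel)"
      by (rule nn_integral_lborel_translation[symmetric]) simp
    also have "\<dots> = (\<integral>\<^sup>+x. f (T x + y) \<partial>lborel)"
      by (simp add: linear_add[OF lin] T_inv add.commute)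
    finally show "(\<integral>\<^sup>+x. f (T x) \<partial>lborel) * indicator ?B y
        = (\<integral>\<^sup>+x. f (T x + y) * indicator ?B y \<partial>lborel)"
      by (simp add: nn_integral_multc)
  qed
  also have "\<dots> = (\<integral>\<^sup>+x. (\<integral>\<^sup>+y. f (T x + y) * indicator ?B y \<partial>lborel) \<partial>lborel)"
    by (rule lborel_pair.Fubini') measurable
  also have "\<dots> = (\<integral>\<^sup>+x. (\<integral>\<^sup>+y. f y * indicator ?B (y - T x) \<partial>lborel) \<partial>lborel)"
    using nn_integral_lborel_translation[of "\<lambda>y. f y * indicator ?B (y - T x)" "T x" for x] by simp
  also have "\<dots> = (\<integral>\<^sup>+y. (\<integral>\<^sup>+x. f y * indicator ?B (y - T x) \<partial>lborel) \<partial>lborel)"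
    by (rule lborel_pair.Fubini') simp
  also have "\<dots> = (\<integral>\<^sup>+y. f y * ?V \<partial>lborel)"
  proof (rule nn_integral_cong)
    fix y :: 'a
    \<comment> \<open>The ball around \<open>y\<close> is pulled back by \<open>T\<close> to the ball around the preimage of \<open>y\<close>.\<close>
    have "norm (y - T x) = norm (inv T y - x)" for x
      using norm_T[of "inv T y - x"] by (simp add: linear_diff[OF lin] T_inv)
    then have "(\<integral>\<^sup>+x. indicator ?B (y - T x) \<partial>lborel) = (\<integral>\<^sup>+x. indicator ?B (inv T y - x) \<partial>lborel :: ennreal)"
      by (simp add: indicator_def)
    also have "\<dots> = (\<integral>\<^sup>+x. indicator ?B x \<partial>lborel)"
      by (rule nn_integral_lborel_reflection) simp
    finally show "(\<integral>\<^sup>+x. f y * indicator ?B (y - T x) \<partial>lborel) = f y * ?V"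
      by (simp add: nn_integral_cmult)
  qed
  also have "\<dots> = (\<integral>\<^sup>+y. f y \<partial>lborel) * ?V"
    by (simp add: nn_integral_multc)
  finally have "?V * (\<integral>\<^sup>+x. f (T x) \<partial>lborel) = ?V * (\<integral>\<^sup>+x. f x \<partial>lborel)"
    by (simp only: mult.commute)
  moreover have "0 < ?V" "?V < \<infinity>"
    by (simp_all add: emeasure_cball)
  ultimately show ?thesis
    by (auto simp: ennreal_mult_cancel_left)
qed

section \<open>Integrals of homogeneous functions over balls\<close>

lemma nn_integral_cball_homogeneous:
  fixes f :: "'a::euclidean_space \<Rightarrow> ennreal"
  assumes [measurable]: "f \<in> borel_measurable borel"
    and hom: "\<And>c x. c > 0 \<Longrightarrow> f (c *\<^sub>R x) = f x" and "t > 0"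
  shows "(\<integral>\<^sup>+x\<in>cball 0 t. f x \<partial>lborel) = ennreal (t ^ DIM('a)) * (\<integral>\<^sup>+x\<in>cball 0 1. f x \<partial>lborel)"
proof -
  have "(\<integral>\<^sup>+x\<in>cball 0 t. f x \<partial>lborel)
      = ennreal (\<bar>t\<bar> ^ DIM('a)) * (\<integral>\<^sup>+x. f (t *\<^sub>R x) * indicator (cball 0 t) (t *\<^sub>R x) \<partial>lborel)"
    using \<open>t > 0\<close> by (intro nn_integral_lborel_scaling) auto
  also have "(\<integral>\<^sup>+x. f (t *\<^sub>R x) * indicator (cball 0 t) (t *\<^sub>R x) \<partial>lborel) = (\<integral>\<^sup>+x\<in>cball 0 1. f x \<partial>lborel)"
    using \<open>t > 0\<close> by (intro nn_integral_cong) (simp add: hom indicator_def)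
  finally show ?thesis using \<open>t > 0\<close> by simp
qed

text \<open>On the unit ball, \<open>1 - norm x\<close> is the length of the interval of those radii \<open>t \<le> 1\<close> for which the
  ball of radius \<open>t\<close> contains \<open>x\<close>. By Fubini, integrating \<open>f x * (1 - norm x)\<close> amounts to
  integrating over \<open>t\<close> the integrals of \<open>f\<close> over these balls, which are proportional to the
  \<open>d\<close>-th power of \<open>t\<close> where \<open>d\<close> is the dimension; this gives the factor \<open>1 / (d + 1)\<close>.
  The identity is written as a sum because the integrals are extended reals. It replaces
  integration in polar coordinates: it relates the mean over directions to the mean of a function
  that is homogeneous of degree one.\<close>

lemma nn_integral_ball_norm_homogeneous:
  fixes f :: "'a::euclidean_space \<Rightarrow> ennreal"
  assumes [measurable]: "f \<in> borel_measurable borel"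
    and hom: "\<And>c x. c > 0 \<Longrightarrow> f (c *\<^sub>R x) = f x"
  shows "(\<integral>\<^sup>+x\<in>cball 0 1. f x \<partial>lborel) = (\<integral>\<^sup>+x\<in>cball 0 1. f x * ennreal (norm x) \<partial>lborel)
           + (\<integral>\<^sup>+x\<in>cball 0 1. f x \<partial>lborel) * ennreal (1 / (DIM('a) + 1))"
proof -
  let ?J = "\<integral>\<^sup>+x\<in>cball 0 1. f x \<partial>lborel"
  have "?J = (\<integral>\<^sup>+x. f x * indicator (cball 0 1) x * ennreal (norm x)
                 + f x * indicator (cball 0 1) x * ennreal (1 - norm x) \<partial>lborel)"
  proof (rule nn_integral_cong)
    fix x :: 'a
    show "f x * indicator (cball 0 1) x = f x * indicator (cball 0 1) x * ennreal (norm x)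
                 + f x * indicator (cball 0 1) x * ennreal (1 - norm x)"
      by (auto simp: indicator_def distrib_left[symmetric] ennreal_plus[symmetric] simp del: ennreal_plus)
  qed
  also have "\<dots> = (\<integral>\<^sup>+x\<in>cball 0 1. f x * ennreal (norm x) \<partial>lborel)
      + (\<integral>\<^sup>+x. f x * indicator (cball 0 1) x * ennreal (1 - norm x) \<partial>lborel)"
    by (subst nn_integral_add) (auto simp: mult_ac)
  also have "(\<integral>\<^sup>+x. f x * indicator (cball 0 1) x * ennreal (1 - norm x) \<partial>lborel)
      = (\<integral>\<^sup>+x. (\<integral>\<^sup>+t. f x * indicator (cball 0 1) x * indicator {norm x..1} t \<partial>lborel) \<partial>lborel)"
    by (intro nn_integral_cong, case_tac "norm x \<le> 1") (auto simp: nn_integral_cmult)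
  also have "\<dots> = (\<integral>\<^sup>+t. (\<integral>\<^sup>+x. f x * indicator (cball 0 1) x * indicator {norm x..1} t \<partial>lborel) \<partial>lborel)"
    by (rule lborel_pair.Fubini') (simp add: indicator_def)
  also have "\<dots> = (\<integral>\<^sup>+t. ?J * ennreal (t ^ DIM('a) * indicator {0..1} t) \<partial>lborel)"
  proof (rule nn_integral_cong_AE)
    \<comment> \<open>Homogeneity says nothing about the ball of radius 0, whence the exception of a null set.\<close>
    have "AE t in lborel. t \<noteq> (0::real)"
      by (rule AE_lborel_singleton)
    then show "AE t in lborel. (\<integral>\<^sup>+x. f x * indicator (cball 0 1) x * indicator {norm x..1} t \<partial>lborel)
        = ?J * ennreal (t ^ DIM('a) * indicator {0..1} t)"
    proof eventually_elim
      case (elim t)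
      show ?case
      proof (cases "0 < t \<and> t \<le> 1")
        case True
        then have "(\<integral>\<^sup>+x. f x * indicator (cball 0 1) x * indicator {norm x..1} t \<partial>lborel)
            = (\<integral>\<^sup>+x\<in>cball 0 t. f x \<partial>lborel)"
          by (intro nn_integral_cong) (auto simp: indicator_def)
        with True show ?thesis
          using nn_integral_cball_homogeneous[OF assms, of t] by (simp add: mult.commute)
      next
        case False
        with elim have "t \<notin> {norm x..1}" for x :: 'a
          using norm_ge_zero[of x] by (simp del: norm_ge_zero)
        then have "(\<integral>\<^sup>+x. f x * indicator (cball 0 1) x * indicator {norm x..1} t \<partial>lborel)
            = (\<integral>\<^sup>+(x::'a). 0 \<partial>lborel)"
          by (intro nn_integral_cong) simp
        moreover have "ennreal (t ^ DIM('a) * indicator {0..1} t) = 0"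
          using False elim by (auto simp: indicator_def)
        ultimately show ?thesis by simp
      qed
    qed
  qed
  also have "\<dots> = ?J * (\<integral>\<^sup>+t. ennreal (t ^ DIM('a) * indicator {0..1} t) \<partial>lborel)"
    by (intro nn_integral_cmult) simp
  also have "(\<integral>\<^sup>+t. ennreal (t ^ DIM('a) * indicator {0..1} t) \<partial>lborel) = ennreal (1 / (DIM('a) + 1))"
  proof -
    have "((\<lambda>t. t ^ k) has_integral (1 ^ Suc k / Suc k - 0 ^ Suc k / Suc k)) {0..1::real}" for k
      by (rule fundamental_theorem_of_calculus)
         (auto intro!: derivative_eq_intros simp del: power_Suc
            simp flip: has_real_derivative_iff_has_vector_derivative)
    then have "((\<lambda>t. t ^ DIM('a)) has_integral (1 / (DIM('a) + 1))) {0..1::real}"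
      by (simp add: add.commute)
    from nn_integral_has_integral_lebesgue[OF _ this] show ?thesis
      by (simp add: mult.commute)
  qed
  finally show ?thesis .
qed

section \<open>The integral of a linear form over the unit ball\<close>

text \<open>The power \<open>m + 2\<close> of \<open>sqrt (1 - y\<^sup>2)\<close>, divided by \<open>-(m + 2)\<close>, is an antiderivative of
  \<open>y * sqrt (1 - y\<^sup>2) ^ m\<close>. The chain rule fails at the end points, where the square root
  vanishes, so the fundamental theorem is applied with derivatives in the interior, on each side
  of 0.\<close>

lemma nn_integral_abs_times_power_of_chord:
  "(\<integral>\<^sup>+(y::real). ennreal (indicator {-1..1} y * (\<bar>y\<bar> * sqrt (1 - y\<^sup>2) ^ m)) \<partial>lborel) = ennreal (2 / (real m + 2))"
proof -
  let ?F = "\<lambda>y::real. sqrt (1 - y\<^sup>2) ^ (m + 2) / (m + 2)"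
  have F_deriv: "(?F has_real_derivative - (y * sqrt (1 - y\<^sup>2) ^ m)) (at y)" if "\<bar>y\<bar> < 1" for y
  proof -
    have pos: "0 < 1 - y\<^sup>2"
      using that by (simp add: abs_square_less_1)
    have "((\<lambda>y. sqrt (1 - y\<^sup>2)) has_real_derivative - (y / sqrt (1 - y\<^sup>2))) (at y)"
      using pos by (auto intro!: derivative_eq_intros simp: field_simps)
    then have "(?F has_real_derivative
        (real (m + 2) * (- (y / sqrt (1 - y\<^sup>2)) * sqrt (1 - y\<^sup>2) ^ (m + 2 - Suc 0))) / (m + 2)) (at y)"
      by (intro DERIV_cdivide DERIV_power)
    also have "(real (m + 2) * (- (y / sqrt (1 - y\<^sup>2)) * sqrt (1 - y\<^sup>2) ^ (m + 2 - Suc 0))) / (m + 2)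
        = - (y * sqrt (1 - y\<^sup>2) ^ m)"
      using pos by (simp del: of_nat_add)
    finally show ?thesis .
  qed
  have right: "((\<lambda>y. \<bar>y\<bar> * sqrt (1 - y\<^sup>2) ^ m) has_integral (- ?F 1 - (- ?F 0))) {0..1}"
    by (rule fundamental_theorem_of_calculus_interior)
       (auto intro!: continuous_intros DERIV_minus[OF F_deriv, simplified]
          simp flip: has_real_derivative_iff_has_vector_derivative)
  have left: "((\<lambda>y. \<bar>y\<bar> * sqrt (1 - y\<^sup>2) ^ m) has_integral (?F 0 - ?F (-1))) {-1..0}"
  proof (rule fundamental_theorem_of_calculus_interior)
    show "(?F has_vector_derivative \<bar>y\<bar> * sqrt (1 - y\<^sup>2) ^ m) (at y)" if "y \<in> {-1<..<0}" for y
      using that F_deriv[of y] by (simp flip: has_real_derivative_iff_has_vector_derivative)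
  qed (auto intro!: continuous_intros)
  have "((\<lambda>y. \<bar>y\<bar> * sqrt (1 - y\<^sup>2) ^ m) has_integral (2 / (real m + 2))) {-1..1}"
    using has_integral_combine[OF _ _ left right] by (simp add: add.commute)
  moreover have "0 \<le> \<bar>y\<bar> * sqrt (1 - y\<^sup>2) ^ m" if "y \<in> {-1..1}" for y :: real
    using that by (simp add: abs_square_le_1 abs_le_iff)
  ultimately show ?thesis
    using nn_integral_has_integral_lebesgue[of "{-1..1}" "\<lambda>y. \<bar>y\<bar> * sqrt (1 - y\<^sup>2) ^ m"] by simp
qed

text \<open>The slice of the unit ball at height \<open>y\<close> in direction \<open>i\<close> is a ball of radius
  \<open>sqrt (1 - y\<^sup>2)\<close> in one dimension less.\<close>

lemma nn_integral_PiM_ball_abs_coordinate: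
  assumes "finite A" "i \<notin> A"
  shows "(\<integral>\<^sup>+f. ennreal \<bar>f i\<bar> * indicator {f. sqrt (\<Sum>j\<in>insert i A. (f j)\<^sup>2) \<le> 1} f
            \<partial>Pi\<^sub>M (insert i A) (\<lambda>_. lborel))
         = ennreal (unit_ball_vol (card A) * (2 / (real (card A) + 2)))"
proof -
  interpret product_sigma_finite "\<lambda>_. lborel :: real measure"
    by standard
  let ?P = "Pi\<^sub>M A (\<lambda>_. lborel :: real measure)"
  let ?S = "\<lambda>r. {f. sqrt (\<Sum>j\<in>A. (f j)\<^sup>2) \<le> r} \<inter> space ?P"
  have "(\<integral>\<^sup>+f. ennreal \<bar>f i\<bar> * indicator {f. sqrt (\<Sum>j\<in>insert i A. (f j)\<^sup>2) \<le> 1} f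
            \<partial>Pi\<^sub>M (insert i A) (\<lambda>_. lborel))
      = (\<integral>\<^sup>+y. \<integral>\<^sup>+f. ennreal \<bar>y\<bar> * indicator {f. sqrt (\<Sum>j\<in>insert i A. (f j)\<^sup>2) \<le> 1} (f(i := y)) \<partial>?P \<partial>lborel)"
    using assms by (subst product_nn_integral_insert_rev) (auto simp: indicator_def)
  also have "\<dots> = (\<integral>\<^sup>+y. ennreal (unit_ball_vol (card A))
      * ennreal (indicator {-1..1} y * (\<bar>y\<bar> * sqrt (1 - y\<^sup>2) ^ card A)) \<partial>lborel)"
  proof (rule nn_integral_cong_AE)
    \<comment> \<open>At these heights the slice is a single point, to which the volume formula for balls of
      positive radius does not apply.\<close>
    have "AE y in lborel. y \<notin> {-1,1::real}"
      by (intro AE_not_in countable_imp_null_set_lborel) auto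
    then show "AE y in lborel.
        (\<integral>\<^sup>+f. ennreal \<bar>y\<bar> * indicator {f. sqrt (\<Sum>j\<in>insert i A. (f j)\<^sup>2) \<le> 1} (f(i := y)) \<partial>?P)
        = ennreal (unit_ball_vol (card A)) * ennreal (indicator {-1..1} y * (\<bar>y\<bar> * sqrt (1 - y\<^sup>2) ^ card A))"
    proof eventually_elim
      case (elim y)
      have sum_eq: "(\<Sum>j\<in>insert i A. ((f(i := y)) j)\<^sup>2) = y\<^sup>2 + (\<Sum>j\<in>A. (f j)\<^sup>2)" for f :: "_ \<Rightarrow> real"
        using assms by (auto intro!: sum.cong)
      show ?case
      proof (cases "\<bar>y\<bar> < 1")
        case True
        then have pos: "0 < 1 - y\<^sup>2"
          by (simp add: abs_square_less_1)
        have "(\<integral>\<^sup>+f. ennreal \<bar>y\<bar> * indicator {f. sqrt (\<Sum>j\<in>insert i A. (f j)\<^sup>2) \<le> 1} (f(i := y)) \<partial>?P)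
            = (\<integral>\<^sup>+f. ennreal \<bar>y\<bar> * indicator (?S (sqrt (1 - y\<^sup>2))) f \<partial>?P)"
          unfolding indicator_def mem_Collect_eq sum_eq
          by (intro nn_integral_cong) (auto simp: le_diff_eq add.commute)
        also have "\<dots> = ennreal \<bar>y\<bar> * emeasure ?P (?S (sqrt (1 - y\<^sup>2)))"
          by (subst nn_integral_cmult_indicator) auto
        also have "\<dots> = ennreal \<bar>y\<bar> * ennreal (unit_ball_vol (card A) * sqrt (1 - y\<^sup>2) ^ card A)"
          using pos assms by (subst emeasure_cball_aux) auto
        finally show ?thesis
          using True pos by (simp add: ennreal_mult' [symmetric] mult_ac abs_less_iff)
      next
        case False
        with elim have "1 < y\<^sup>2"
          using abs_square_le_1[of y] by (auto simp: not_le[symmetric])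
        then have "indicator {f. sqrt (\<Sum>j\<in>insert i A. (f j)\<^sup>2) \<le> 1} (f(i := y)) = (0::ennreal)"
            for f :: "_ \<Rightarrow> real"
          unfolding indicator_def mem_Collect_eq sum_eq
          using sum_nonneg[of A "\<lambda>j. (f j)\<^sup>2"] by (auto simp: not_le)
        moreover have "indicator {-1..1} y = (0::real)"
          using False elim by (auto simp: indicator_def)
        ultimately show ?thesis by simp
      qed
    qed
  qed
  also have "\<dots> = ennreal (unit_ball_vol (card A)) * ennreal (2 / (real (card A) + 2))"
    by (subst nn_integral_cmult) (measurable, simp only: nn_integral_abs_times_power_of_chord)
  also have "\<dots> = ennreal (unit_ball_vol (card A) * (2 / (real (card A) + 2)))"
    by (rule ennreal_mult'[symmetric]) simp
  finally show ?thesis .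
qed

lemma nn_integral_ball_abs_Basis:
  fixes b :: "'a::euclidean_space"
  assumes b: "b \<in> Basis"
  shows "(\<integral>\<^sup>+x\<in>cball 0 1. ennreal \<bar>x \<bullet> b\<bar> \<partial>lborel)
         = ennreal (unit_ball_vol (real DIM('a) - 1) * (2 / (real DIM('a) + 1)))"
proof -
  let ?e = "\<lambda>f. \<Sum>c\<in>Basis. f c *\<^sub>R c :: 'a"
  have ins: "insert b (Basis - {b}) = Basis"
    using b by auto
  have "(\<integral>\<^sup>+x\<in>cball 0 1. ennreal \<bar>x \<bullet> b\<bar> \<partial>lborel)
      = (\<integral>\<^sup>+f. ennreal \<bar>?e f \<bullet> b\<bar> * indicator (cball 0 1) (?e f) \<partial>Pi\<^sub>M Basis (\<lambda>_. lborel))"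
    by (subst lborel_eq, subst nn_integral_distr) auto
  also have "\<dots> = (\<integral>\<^sup>+f. ennreal \<bar>f b\<bar> * indicator {f. sqrt (\<Sum>j\<in>Basis. (f j)\<^sup>2) \<le> 1} f
      \<partial>Pi\<^sub>M Basis (\<lambda>_. lborel))"
  proof (rule nn_integral_cong)
    fix f :: "'a \<Rightarrow> real"
    have "norm (?e f) = sqrt (\<Sum>j\<in>Basis. (f j)\<^sup>2)"
      unfolding norm_conv_dist euclidean_dist_l2[of _ 0] L2_set_def by simp
    then show "ennreal \<bar>?e f \<bullet> b\<bar> * indicator (cball 0 1) (?e f)
        = ennreal \<bar>f b\<bar> * indicator {f. sqrt (\<Sum>j\<in>Basis. (f j)\<^sup>2) \<le> 1} f"
      using b by (simp add: indicator_def)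
  qed
  also have "\<dots> = ennreal (unit_ball_vol (card (Basis - {b})) * (2 / (real (card (Basis - {b})) + 2)))"
    using nn_integral_PiM_ball_abs_coordinate[of "Basis - {b}" b] unfolding ins by simp
  finally have "(\<integral>\<^sup>+x\<in>cball 0 1. ennreal \<bar>x \<bullet> b\<bar> \<partial>lborel)
      = ennreal (unit_ball_vol (card (Basis - {b})) * (2 / (real (card (Basis - {b})) + 2)))" .
  moreover have "real (card (Basis - {b})) = real DIM('a) - 1"
    using b DIM_positive[where 'a='a] by (subst card_Diff_singleton) (auto simp: of_nat_diff)
  ultimately show ?thesis by simp
qed

text \<open>An orthogonal transformation that takes a basis vector to \<open>v\<close> reduces the integral to the one
  of a coordinate.\<close>

lemma nn_integral_ball_abs_inner:
  fixes v :: "real ^ 'n"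
  assumes "norm v = 1"
  shows "(\<integral>\<^sup>+x\<in>cball 0 1. ennreal \<bar>x \<bullet> v\<bar> \<partial>lborel)
         = ennreal (unit_ball_vol (real CARD('n) - 1) * (2 / (real CARD('n) + 1)))"
proof -
  obtain b :: "real ^ 'n" where b: "b \<in> Basis"
    using nonempty_Basis by blast
  then obtain T where T: "orthogonal_transformation T" "T b = v"
    using orthogonal_transformation_exists_1[of b v] assms by auto
  have "(\<integral>\<^sup>+x\<in>cball 0 1. ennreal \<bar>x \<bullet> v\<bar> \<partial>lborel)
      = (\<integral>\<^sup>+x. ennreal \<bar>T x \<bullet> v\<bar> * indicator (cball 0 1) (T x) \<partial>lborel)"
    by (rule nn_integral_lborel_orthogonal_transformation[OF T(1), symmetric]) simp
  also have "\<dots> = (\<integral>\<^sup>+x\<in>cball 0 1. ennreal \<bar>x \<bullet> b\<bar> \<partial>lborel)"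
    using T by (intro nn_integral_cong)
      (auto simp: orthogonal_transformation_def indicator_def orthogonal_transformation_norm[OF T(1)])
  finally show ?thesis
    using nn_integral_ball_abs_Basis[OF b] by simp
qed

section \<open>The mean absolute projection\<close>

text \<open>The mean over the unit sphere in dimension \<open>p\<close> of the absolute inner product with a unit vector.\<close>

definition mean_abs_proj :: "real \<Rightarrow> real" where
  "mean_abs_proj p = Gamma (p / 2) / (sqrt pi * Gamma ((p + 1) / 2))"

lemma mean_abs_proj_nonneg: "0 < p \<Longrightarrow> 0 \<le> mean_abs_proj p"
  unfolding mean_abs_proj_def by (intro divide_nonneg_nonneg mult_nonneg_nonneg) (auto intro!: less_imp_le Gamma_real_pos)

text \<open>Combines \<open>Gamma (z + 1) = z * Gamma z\<close> at \<open>z = p / 2\<close> with the volume formulas in the dimensions \<open>p\<close> and \<open>p - 1\<close>.\<close>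

lemma mean_abs_proj_unit_ball_vol:
  assumes "p > 0"
  shows "mean_abs_proj p * unit_ball_vol p = 2 * unit_ball_vol (p - 1) / p"
proof -
  have *: "Gamma (p / 2) > 0" "Gamma ((p + 1) / 2) > 0"
    using assms by (auto intro!: Gamma_real_pos)
  have Gamma_step: "Gamma (p / 2 + 1) = p / 2 * Gamma (p / 2)"
    using assms by (intro Gamma_plus1) (auto simp: nonpos_Ints_def)
  have "pi powr (p / 2) = pi powr ((p - 1) / 2) * sqrt pi"
    by (simp add: powr_half_sqrt [symmetric] powr_add [symmetric] field_simps)
  then have vol: "unit_ball_vol p = pi powr ((p - 1) / 2) * sqrt pi / (p / 2 * Gamma (p / 2))"
    unfolding unit_ball_vol_def Gamma_step by simp
  have "(p - 1) / 2 + 1 = (p + 1) / 2"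
    by (simp add: field_simps)
  then have vol': "unit_ball_vol (p - 1) = pi powr ((p - 1) / 2) / Gamma ((p + 1) / 2)"
    unfolding unit_ball_vol_def by (simp only:)
  have "g / (s * g') * (a * s / (p / 2 * g)) = 2 * (a / g') / p" if "g > 0" "s > 0" "g' > 0" for a g g' s
    using that assms by (simp add: field_simps)
  with * show ?thesis
    unfolding mean_abs_proj_def vol vol' by simp
qed

text \<open>The integrand depends on the direction of \<open>x\<close> only, and multiplying it by \<open>norm x\<close> gives
  \<open>\<bar>x \<bullet> v\<bar>\<close>, whose integral is known by slicing. The relation between the two integrals is a linear
  equation for the integral \<open>J\<close> over the unit ball.\<close>

lemma nn_integral_cball_abs_sgn_inner:
  fixes v :: "real ^ 'n"
  assumes v: "norm v = 1" and "t > 0"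
  shows "(\<integral>\<^sup>+x\<in>cball 0 t. ennreal \<bar>sgn x \<bullet> v\<bar> \<partial>lborel)
         = ennreal (mean_abs_proj CARD('n) * unit_ball_vol CARD('n) * t ^ CARD('n))"
proof -
  let ?p = "real CARD('n)"
  let ?f = "\<lambda>x. ennreal \<bar>sgn x \<bullet> v\<bar>"
  let ?J = "\<integral>\<^sup>+x\<in>cball 0 1. ?f x \<partial>lborel"
  have f_meas: "?f \<in> borel_measurable borel"
    unfolding sgn_div_norm by measurable
  have hom: "?f (c *\<^sub>R x) = ?f x" if "c > 0" for c x
    using that by (simp add: sgn_scaleR)
  have f_norm: "?f x * ennreal (norm x) = ennreal \<bar>x \<bullet> v\<bar>" for x
    by (cases "x = 0") (simp_all add: sgn_div_norm abs_mult ennreal_mult' [symmetric])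
  have "?f x \<le> 1" for x
    using Cauchy_Schwarz_ineq2[of "sgn x" v] v by (cases "x = 0") (simp_all add: norm_sgn)
  then have "?J \<le> (\<integral>\<^sup>+x. indicator (cball 0 1) x \<partial>(lborel :: (real ^ 'n) measure))"
    by (intro nn_integral_mono) (simp add: indicator_def)
  also have "\<dots> < \<infinity>"
    by (simp add: emeasure_cball)
  finally obtain J where J: "?J = ennreal J" "J \<ge> 0"
    by (cases ?J) auto
  have "ennreal J = ennreal (unit_ball_vol (?p - 1) * (2 / (?p + 1))) + ennreal J * ennreal (1 / (?p + 1))"
    using nn_integral_ball_norm_homogeneous[OF f_meas hom] nn_integral_ball_abs_inner[OF v]
    by (simp add: f_norm J add.commute)
  also have "\<dots> = ennreal (unit_ball_vol (?p - 1) * (2 / (?p + 1)) + J * (1 / (?p + 1)))"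
    using J(2) by (subst ennreal_mult' [symmetric], simp, subst ennreal_plus) (auto simp: Suc_le_eq)
  finally have "J = unit_ball_vol (?p - 1) * (2 / (?p + 1)) + J * (1 / (?p + 1))"
    using J(2) by (subst (asm) ennreal_inj) (auto intro!: add_nonneg_nonneg simp: Suc_le_eq)
  then have "J * (?p + 1) = (unit_ball_vol (?p - 1) * (2 / (?p + 1)) + J * (1 / (?p + 1))) * (?p + 1)"
    by (rule arg_cong)
  also have "\<dots> = 2 * unit_ball_vol (?p - 1) + J"
  proof -
    have "a / q * q = a" if "q > 0" for a q :: real
      using that by simp
    then have "2 / (?p + 1) * (?p + 1) = 2" "1 / (?p + 1) * (?p + 1) = 1"
      by (auto simp del: times_divide_eq_left)
    then show ?thesis
      by (simp only: distrib_right[of _ _ "?p + 1"] mult.assoc)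
  qed
  finally have "J = 2 * unit_ball_vol (?p - 1) / ?p"
    by (simp add: field_simps)
  also have "\<dots> = mean_abs_proj ?p * unit_ball_vol ?p"
    by (subst mean_abs_proj_unit_ball_vol) auto
  finally have "?J = ennreal (mean_abs_proj ?p * unit_ball_vol ?p)"
    using J by simp
  then show ?thesis
    using nn_integral_cball_homogeneous[OF f_meas hom \<open>t > 0\<close>] \<open>t > 0\<close>
    by (simp add: ennreal_mult' [symmetric] mult_ac)
qed

lemma
  fixes v :: "real ^ 'n"
  assumes v: "norm v = 1" and "t > 0"
  shows set_integrable_cball_abs_sgn_inner: "set_integrable lborel (cball 0 t) (\<lambda>x. \<bar>sgn x \<bullet> v\<bar>)"
    and LINT_cball_abs_sgn_inner: "(LINT x:cball 0 t|lborel. \<bar>sgn x \<bullet> v\<bar>)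
         = mean_abs_proj CARD('n) * (unit_ball_vol CARD('n) * t ^ CARD('n))"
proof -
  let ?g = "\<lambda>x. indicator (cball 0 t) x *\<^sub>R \<bar>sgn x \<bullet> v\<bar>"
  have meas: "?g \<in> borel_measurable lborel"
    unfolding sgn_div_norm by measurable
  have nn: "(\<integral>\<^sup>+x. ennreal (?g x) \<partial>lborel)
      = ennreal (mean_abs_proj CARD('n) * unit_ball_vol CARD('n) * t ^ CARD('n))"
    using nn_integral_cball_abs_sgn_inner[OF assms]
    by (simp add: ennreal_mult' ennreal_indicator mult.commute)
  show "set_integrable lborel (cball 0 t) (\<lambda>x. \<bar>sgn x \<bullet> v\<bar>)"
    unfolding set_integrable_def
    by (rule integrableI_nn_integral_finite[OF meas _ nn]) (auto simp: mean_abs_proj_nonneg \<open>t > 0\<close> less_imp_le)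
  show "(LINT x:cball 0 t|lborel. \<bar>sgn x \<bullet> v\<bar>)
         = mean_abs_proj CARD('n) * (unit_ball_vol CARD('n) * t ^ CARD('n))"
    unfolding set_lebesgue_integral_def
    using meas nn \<open>t > 0\<close> by (subst integral_eq_nn_integral) (auto simp: mean_abs_proj_nonneg)
qed

section \<open>The lower bound\<close>

text \<open>The maximum over the directions is at least the mean, which is the same for every \<open>u i\<close>. The mean
  is taken over the directions \<open>sgn x\<close> of the points \<open>x\<close> of the unit ball.\<close>

lemma mean_abs_proj_le_energy:
  fixes u :: "nat \<Rightarrow> real ^ 'n"
  assumes u: "u \<in> {..<n} \<rightarrow> sphere 0 1"
  shows "real n * mean_abs_proj CARD('n) \<le> energy n u"
proof -
  let ?B = "cball 0 1 :: (real ^ 'n) set" and ?w = "unit_ball_vol CARD('n)"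
  have norm_u: "norm (u i) = 1" if "i < n" for i
    using u that by (auto simp: Pi_iff)
  obtain v where v: "v \<in> sphere 0 1" "energy n u = (\<Sum>i<n. \<bar>u i \<bullet> v\<bar>)"
    "\<And>w. w \<in> sphere 0 1 \<Longrightarrow> (\<Sum>i<n. \<bar>u i \<bullet> w\<bar>) \<le> energy n u"
    using energy_attained by metis
  have E: "(\<Sum>i<n. \<bar>sgn x \<bullet> u i\<bar>) \<le> energy n u" for x
  proof (cases "x = 0")
    case True
    then show ?thesis by (simp add: v(2) sum_nonneg)
  next
    case False
    then show ?thesis using v(3)[of "sgn x"] by (simp add: norm_sgn inner_commute)
  qed
  have int: "set_integrable lborel ?B (\<lambda>x. \<bar>sgn x \<bullet> u i\<bar>)" if "i < n" for i
    using set_integrable_cball_abs_sgn_inner[OF norm_u[OF that], of 1] by simp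
  have const: "set_integrable lborel ?B (\<lambda>_. energy n u)"
    unfolding set_integrable_def by (simp add: emeasure_cball)
  have "real n * mean_abs_proj CARD('n) * ?w = (\<Sum>i<n. LINT x:?B|lborel. \<bar>sgn x \<bullet> u i\<bar>)"
    using LINT_cball_abs_sgn_inner[OF norm_u, of _ 1] by simp
  also have "\<dots> = (LINT x:?B|lborel. (\<Sum>i<n. \<bar>sgn x \<bullet> u i\<bar>))"
    unfolding set_lebesgue_integral_def scaleR_sum_right
    using int by (intro Bochner_Integration.integral_sum[symmetric]) (simp add: set_integrable_def)
  also have "\<dots> \<le> (LINT x:?B|lborel. energy n u)"
  proof (rule set_integral_mono[OF _ const])
    show "set_integrable lborel ?B (\<lambda>x. \<Sum>i<n. \<bar>sgn x \<bullet> u i\<bar>)"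
      unfolding set_integrable_def scaleR_sum_right
      using int by (intro Bochner_Integration.integrable_sum) (simp add: set_integrable_def)
  qed (rule E)
  also have "\<dots> = energy n u * ?w"
    by (simp add: set_lebesgue_integral_def content_cball)
  finally show ?thesis
    by (rule mult_right_le_imp_le) simp
qed

section \<open>Grid cubes and elementary estimates\<close>

text \<open>The half-open cubes of side \<open>h\<close> of the grid with the origin as a node. Through the floor
  function these cubes are disjoint and not merely non-overlapping, and every point has its cube.\<close>

definition grid_cube :: "real \<Rightarrow> ('n::finite \<Rightarrow> int) \<Rightarrow> (real ^ 'n) set" where
  "grid_cube h z = {x. \<forall>i. \<lfloor>x $ i / h\<rfloor> = z i}"

definition grid_corner :: "real \<Rightarrow> ('n::finite \<Rightarrow> int) \<Rightarrow> real ^ 'n" where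
  "grid_corner h z = (\<chi> i. h * of_int (z i))"

lemma grid_corner_in_cube: "h > 0 \<Longrightarrow> grid_corner h z \<in> grid_cube h z"
  by (simp add: grid_corner_def grid_cube_def)

lemma disjoint_grid_cubes: "z \<noteq> z' \<Longrightarrow> grid_cube h z \<inter> grid_cube h z' = {}"
  by (auto simp: grid_cube_def fun_eq_iff)

lemma grid_cube_borel [measurable]: "grid_cube h z \<in> sets (borel :: (real ^ 'n::finite) measure)"
proof -
  have "Measurable.pred borel (\<lambda>x::real ^ 'n. \<forall>i. \<lfloor>x $ i / h\<rfloor> = z i)"
    by measurable
  then show ?thesis
    unfolding grid_cube_def by (simp add: pred_def)
qed

text \<open>The cube lies between an open and a closed box of the same volume.\<close>

lemma emeasure_grid_cube:
  assumes "h > 0"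
  shows "emeasure lborel (grid_cube h z :: (real ^ 'n::finite) set) = ennreal (h ^ CARD('n))"
proof -
  let ?a = "grid_corner h z" and ?b = "grid_corner h z + (\<chi> i. h)"
  have "box ?a ?b \<subseteq> grid_cube h z" "grid_cube h z \<subseteq> cbox ?a ?b"
    using assms by (auto simp: grid_corner_def grid_cube_def mem_box_cart floor_eq_iff field_simps less_imp_le)
  then have le: "emeasure lborel (box ?a ?b) \<le> emeasure lborel (grid_cube h z)"
      "emeasure lborel (grid_cube h z) \<le> emeasure lborel (cbox ?a ?b)"
    by (auto intro!: emeasure_mono)
  have ab: "?a \<bullet> j \<le> ?b \<bullet> j" if "j \<in> Basis" for j
    using that assms by (auto simp: Basis_vec_def inner_axis grid_corner_def)
  have "(\<Prod>j\<in>Basis. (?b - ?a) \<bullet> j) = (\<Prod>j\<in>(Basis :: (real ^ 'n) set). h)"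
    by (intro prod.cong) (auto simp: Basis_vec_def inner_axis)
  then have "emeasure lborel (box ?a ?b) = ennreal (h ^ CARD('n))"
      "emeasure lborel (cbox ?a ?b) = ennreal (h ^ CARD('n))"
    using ab by (simp_all add: emeasure_lborel_box emeasure_lborel_cbox)
  with le show ?thesis by simp
qed

lemma grid_cube_diameter:
  fixes x y :: "real ^ 'n" and h :: real
  assumes "x \<in> grid_cube h z" "y \<in> grid_cube h z" "h > 0"
  shows "norm (x - y) \<le> CARD('n) * h"
proof -
  have "\<bar>(x - y) $ i\<bar> \<le> h" for i :: 'n
  proof -
    have "\<lfloor>x $ i / h\<rfloor> = \<lfloor>y $ i / h\<rfloor>"
      using assms by (simp add: grid_cube_def)
    then have "\<bar>x $ i / h - y $ i / h\<bar> < 1"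
      by linarith
    then show ?thesis
      using \<open>h > 0\<close> by (simp add: diff_divide_distrib[symmetric] abs_divide)
  qed
  then have "(\<Sum>i\<in>UNIV. \<bar>(x - y) $ i\<bar>) \<le> (\<Sum>i\<in>(UNIV :: 'n set). h)"
    by (intro sum_mono)
  then show ?thesis
    using norm_le_l1_cart[of "x - y"] by simp
qed

text \<open>The constant 2 comes from moving first the vector and then its norm.\<close>

lemma norm_sgn_diff_le:
  fixes x y :: "'a::real_normed_vector"
  assumes "norm x \<ge> 1" "norm y \<ge> 1"
  shows "norm (sgn x - sgn y) \<le> 2 * norm (x - y)"
proof -
  have nz: "norm x \<noteq> 0" "norm y \<noteq> 0"
    using assms by linarith+
  have x: "norm x *\<^sub>R sgn x = x" and y: "norm y *\<^sub>R sgn y = y"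
    using nz by (simp_all add: sgn_div_norm)
  have "norm x *\<^sub>R (sgn x - sgn y) = (x - y) + (norm y - norm x) *\<^sub>R sgn y"
    unfolding scaleR_diff_right scaleR_diff_left x y by simp
  then have "norm x * norm (sgn x - sgn y) = norm ((x - y) + (norm y - norm x) *\<^sub>R sgn y)"
    by (metis norm_scaleR abs_norm_cancel)
  also have "\<dots> \<le> norm (x - y) + norm ((norm y - norm x) *\<^sub>R sgn y)"
    by (rule norm_triangle_ineq)
  also have "\<dots> = norm (x - y) + \<bar>norm y - norm x\<bar>"
    using nz by (simp add: norm_sgn)
  also have "\<bar>norm y - norm x\<bar> \<le> norm (x - y)"
    using norm_triangle_ineq3[of y x] by (simp add: norm_minus_commute)
  finally have "norm x * norm (sgn x - sgn y) \<le> 2 * norm (x - y)"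
    by simp
  moreover have "1 * norm (sgn x - sgn y) \<le> norm x * norm (sgn x - sgn y)"
    using assms by (intro mult_right_mono) auto
  ultimately show ?thesis by simp
qed

lemma power_diff_le_mult:
  fixes a b :: real
  assumes "0 \<le> b" "b \<le> a" "a \<le> 2"
  shows "a ^ k - b ^ k \<le> real k * 2 ^ k * (a - b)"
proof (induction k)
  case (Suc k)
  have "a ^ Suc k - b ^ Suc k = a * (a ^ k - b ^ k) + (a - b) * b ^ k"
    by (simp add: algebra_simps)
  also have "\<dots> \<le> 2 * (real k * 2 ^ k * (a - b)) + (a - b) * 2 ^ k"
    using assms Suc power_mono[of b a k] power_mono[of b 2 k]
    by (intro add_mono mult_mono mult_left_mono) auto
  also have "\<dots> \<le> real (Suc k) * 2 ^ Suc k * (a - b)"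
    using assms by (simp add: algebra_simps mult_left_mono)
  finally show ?case .
qed simp

section \<open>Filling a shell with cubes\<close>

abbreviation shell :: "real \<Rightarrow> real \<Rightarrow> 'a::euclidean_space set" where
  "shell r s \<equiv> cball 0 s - cball 0 r"

lemma measure_shell:
  assumes "0 \<le> r" "r \<le> s"
  shows "measure lborel (shell r s :: 'a::euclidean_space set)
         = unit_ball_vol DIM('a) * (s ^ DIM('a) - r ^ DIM('a))"
  using assms by (subst measure_Diff) (auto simp: content_cball emeasure_cball algebra_simps)

lemma emeasure_shell_finite: "emeasure lborel (shell r s :: 'a::euclidean_space set) < \<infinity>"
proof -
  have "emeasure lborel (shell r s :: 'a set) \<le> emeasure lborel (cball 0 s :: 'a set)"
    by (intro emeasure_mono) auto
  then show ?thesis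
    using emeasure_lborel_cball_finite[of "0 :: 'a" s] by (auto intro: le_less_trans)
qed

lemma
  fixes v :: "real ^ 'n"
  assumes v: "norm v = 1" and rs: "0 < r" "r \<le> s"
  shows set_integrable_shell_abs_sgn_inner: "set_integrable lborel (shell r s) (\<lambda>x. \<bar>sgn x \<bullet> v\<bar>)"
    and LINT_shell_abs_sgn_inner: "(LINT x:shell r s|lborel. \<bar>sgn x \<bullet> v\<bar>)
         = mean_abs_proj CARD('n) * measure lborel (shell r s :: (real ^ 'n) set)"
proof -
  have int_r: "set_integrable lborel (cball 0 r) (\<lambda>x. \<bar>sgn x \<bullet> v\<bar>)"
    and int_s: "set_integrable lborel (cball 0 s) (\<lambda>x. \<bar>sgn x \<bullet> v\<bar>)"
    using rs by (auto intro!: set_integrable_cball_abs_sgn_inner v)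
  show int: "set_integrable lborel (shell r s) (\<lambda>x. \<bar>sgn x \<bullet> v\<bar>)"
    by (rule set_integrable_subset[OF int_s]) auto
  have "cball 0 s = shell r s \<union> (cball 0 r :: (real ^ 'n) set)"
    using rs by auto
  then have "(LINT x:cball 0 s|lborel. \<bar>sgn x \<bullet> v\<bar>)
      = (LINT x:shell r s|lborel. \<bar>sgn x \<bullet> v\<bar>) + (LINT x:cball 0 r|lborel. \<bar>sgn x \<bullet> v\<bar>)"
    using set_integral_Un[OF _ int int_r] by auto
  then show "(LINT x:shell r s|lborel. \<bar>sgn x \<bullet> v\<bar>)
         = mean_abs_proj CARD('n) * measure lborel (shell r s :: (real ^ 'n) set)"
    using rs LINT_cball_abs_sgn_inner[OF v, of r] LINT_cball_abs_sgn_inner[OF v, of s]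
    by (simp add: measure_shell algebra_simps)
qed

definition inner_cubes :: "real \<Rightarrow> (real ^ 'n::finite) set \<Rightarrow> ('n \<Rightarrow> int) set" where
  "inner_cubes h A = {z. grid_cube h z \<subseteq> A}"

lemma measure_UN_grid_cubes:
  fixes h :: real
  assumes "h > 0" "finite Z"
  shows "measure lborel (\<Union>z\<in>Z. grid_cube h z :: (real ^ 'n::finite) set) = card Z * h ^ CARD('n)"
proof -
  have "measure lborel (\<Union>z\<in>Z. grid_cube h z :: (real ^ 'n) set)
      = (\<Sum>z\<in>Z. measure lborel (grid_cube h z :: (real ^ 'n) set))"
    using assms by (intro measure_finite_Union)
      (auto simp: disjoint_family_on_def disjoint_grid_cubes emeasure_grid_cube)
  then show ?thesis
    using assms by (simp add: measure_def emeasure_grid_cube)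
qed

text \<open>Disjoint cubes of equal volume inside a set of finite volume: there are only finitely many, as
  every finite collection of them obeys the volume bound.\<close>

lemma finite_card_inner_cubes:
  fixes A :: "(real ^ 'n) set" and h :: real
  assumes "h > 0" and A: "A \<in> sets lborel" "emeasure lborel A < \<infinity>"
  shows "finite (inner_cubes h A)" "card (inner_cubes h A) * h ^ CARD('n) \<le> measure lborel A"
proof -
  have bound: "card F * h ^ CARD('n) \<le> measure lborel A" if "F \<subseteq> inner_cubes h A" "finite F" for F
  proof -
    have "measure lborel (\<Union>z\<in>F. grid_cube h z) \<le> measure lborel A"
      using that A by (intro measure_mono_fmeasurable)
        (auto simp: inner_cubes_def fmeasurable_def intro!: sets.finite_UN)
    then show ?thesis
      using measure_UN_grid_cubes[OF \<open>h > 0\<close> \<open>finite F\<close>] by simp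
  qed
  show fin: "finite (inner_cubes h A)"
  proof -
    have "card F \<le> nat \<lfloor>measure lborel A / h ^ CARD('n)\<rfloor>" if "F \<subseteq> inner_cubes h A" "finite F" for F
      using bound[OF that] \<open>h > 0\<close> by (auto intro!: le_nat_floor simp: field_simps)
    then show ?thesis
      using finite_if_finite_subsets_card_bdd by blast
  qed
  show "card (inner_cubes h A) * h ^ CARD('n) \<le> measure lborel A"
    by (rule bound[OF _ fin]) simp
qed

text \<open>The diameter of a cube is at most \<open>d\<close>, so the cube of a point at least that far from the
  boundary of the shell stays inside the shell.\<close>

lemma shell_subset_UN_inner_cubes:
  fixes h :: real
  defines "d \<equiv> CARD('n::finite) * h"
  assumes "h > 0"
  shows "shell (r + d) (s - d) \<subseteq> (\<Union>z\<in>inner_cubes h (shell r s). grid_cube h z :: (real ^ 'n) set)"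
proof
  fix x :: "real ^ 'n"
  assume x: "x \<in> shell (r + d) (s - d)"
  define z where "z i = \<lfloor>x $ i / h\<rfloor>" for i
  have xz: "x \<in> grid_cube h z"
    by (simp add: grid_cube_def z_def)
  have "y \<in> shell r s" if "y \<in> grid_cube h z" for y
    using grid_cube_diameter[OF xz that \<open>h > 0\<close>] x norm_triangle_ineq3[of x y] by (auto simp: d_def)
  then have "z \<in> inner_cubes h (shell r s)"
    unfolding inner_cubes_def by blast
  then show "x \<in> (\<Union>z\<in>inner_cubes h (shell r s). grid_cube h z)"
    using xz by blast
qed

text \<open>The part of the shell that the inner cubes miss lies within distance \<open>d\<close> of the boundary, hence
  in two thin shells whose total volume is at most a constant times \<open>d\<close>.\<close>

lemma card_inner_cubes_shell_ge:
  fixes h :: real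
  defines "d \<equiv> CARD('n::finite) * h" and "A \<equiv> shell 1 2 :: (real ^ 'n) set"
  assumes "h > 0" "d \<le> 1/2"
  shows "measure lborel A - card (inner_cubes h A) * h ^ CARD('n)
         \<le> 2 * unit_ball_vol CARD('n) * CARD('n) * 2 ^ CARD('n) * d"
proof -
  let ?p = "CARD('n)" and ?Z = "inner_cubes h A" and ?w = "unit_ball_vol CARD('n)"
  have "d \<ge> 0"
    using \<open>h > 0\<close> by (simp add: d_def)
  have fin: "finite ?Z"
    unfolding A_def using \<open>h > 0\<close> by (intro finite_card_inner_cubes(1) emeasure_shell_finite) auto
  have "measure lborel (shell (1 + d) (2 - d) :: (real ^ 'n) set) \<le> measure lborel (\<Union>z\<in>?Z. grid_cube h z)"
    using shell_subset_UN_inner_cubes[where 'n='n and r=1 and s=2, OF \<open>h > 0\<close>] fin \<open>h > 0\<close>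
    by (intro measure_mono_fmeasurable fmeasurable.finite_UN)
       (auto simp: A_def d_def fmeasurable_def emeasure_grid_cube)
  then have "?w * ((2 - d) ^ ?p - (1 + d) ^ ?p) \<le> card ?Z * h ^ ?p"
    using measure_UN_grid_cubes[OF \<open>h > 0\<close> fin] \<open>d \<ge> 0\<close> \<open>d \<le> 1/2\<close> by (simp add: measure_shell)
  then have "measure lborel A - card ?Z * h ^ ?p
      \<le> ?w * (2 ^ ?p - 1 ^ ?p) - ?w * ((2 - d) ^ ?p - (1 + d) ^ ?p)"
    by (simp add: A_def measure_shell)
  also have "\<dots> = ?w * ((2 ^ ?p - (2 - d) ^ ?p) + ((1 + d) ^ ?p - 1 ^ ?p))"
    by (simp add: algebra_simps)
  also have "\<dots> \<le> ?w * (real ?p * 2 ^ ?p * (2 - (2 - d)) + real ?p * 2 ^ ?p * ((1 + d) - 1))"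
    using \<open>d \<ge> 0\<close> \<open>d \<le> 1/2\<close> by (intro mult_left_mono add_mono power_diff_le_mult) auto
  finally show ?thesis
    by (simp add: algebra_simps)
qed

text \<open>The sum on the left is a Riemann sum for the integral of \<open>\<bar>sgn x \<bullet> v\<bar>\<close> over the shell. The integrand
  changes by at most \<open>2 * d\<close> within a cube, for every unit vector \<open>v\<close> alike.\<close>

lemma sum_inner_cubes_le:
  fixes h :: real and v :: "real ^ 'n"
  defines "d \<equiv> CARD('n) * h" and "A \<equiv> shell 1 2 :: (real ^ 'n) set"
  assumes "h > 0" and v: "norm v = 1"
  shows "h ^ CARD('n) * (\<Sum>z\<in>inner_cubes h A. \<bar>sgn (grid_corner h z) \<bullet> v\<bar>)
         \<le> (mean_abs_proj CARD('n) + 2 * d) * measure lborel A"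
proof -
  let ?p = "CARD('n)" and ?Z = "inner_cubes h A" and ?f = "\<lambda>x. \<bar>sgn x \<bullet> v\<bar>"
  have "d \<ge> 0"
    using \<open>h > 0\<close> by (simp add: d_def)
  have A: "A \<in> sets lborel" "emeasure lborel A < \<infinity>"
    unfolding A_def by (simp, rule emeasure_shell_finite)
  note Z = finite_card_inner_cubes[OF \<open>h > 0\<close> A]
  have int_A: "set_integrable lborel A ?f"
    unfolding A_def by (rule set_integrable_shell_abs_sgn_inner[OF v]) auto
  have int: "set_integrable lborel (grid_cube h z) ?f" if "z \<in> ?Z" for z
    using that by (intro set_integrable_subset[OF int_A]) (auto simp: inner_cubes_def)
  have fin_cube: "emeasure lborel (grid_cube h z :: (real ^ 'n) set) < \<infinity>" for z
    using \<open>h > 0\<close> by (simp add: emeasure_grid_cube)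
  have const: "set_integrable lborel (grid_cube h z :: (real ^ 'n) set) (\<lambda>_. c)" for z and c :: real
    using fin_cube unfolding set_integrable_def by simp
  have LINT_const: "(LINT x:(grid_cube h z :: (real ^ 'n) set)|lborel. c) = h ^ ?p * c" for z and c :: real
    using \<open>h > 0\<close> by (simp add: set_lebesgue_integral_def measure_def emeasure_grid_cube)
  have cube: "h ^ ?p * ?f (grid_corner h z) \<le> (LINT x:grid_cube h z|lborel. ?f x) + h ^ ?p * (2 * d)"
    if z: "z \<in> ?Z" for z
  proof -
    have near: "?f (grid_corner h z) \<le> ?f x + 2 * d" if x: "x \<in> grid_cube h z" for x
    proof -
      have mem: "x \<in> A" "grid_corner h z \<in> A"
        using z x grid_corner_in_cube[OF \<open>h > 0\<close>] by (auto simp: inner_cubes_def)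
      have "\<bar>(sgn (grid_corner h z) - sgn x) \<bullet> v\<bar> \<le> norm (sgn (grid_corner h z) - sgn x)"
        using Cauchy_Schwarz_ineq2[of _ v] v by simp
      also have "\<dots> \<le> 2 * norm (grid_corner h z - x)"
        using mem by (intro norm_sgn_diff_le) (auto simp: A_def)
      also have "\<dots> \<le> 2 * d"
        using grid_cube_diameter[OF grid_corner_in_cube[OF \<open>h > 0\<close>] x \<open>h > 0\<close>] by (simp add: d_def)
      finally show ?thesis
        by (simp add: inner_diff_left)
    qed
    have "h ^ ?p * ?f (grid_corner h z) = (LINT x:grid_cube h z|lborel. ?f (grid_corner h z))"
      by (simp only: LINT_const)
    also have "\<dots> \<le> (LINT x:grid_cube h z|lborel. ?f x + 2 * d)"
      using near by (intro set_integral_mono const set_integral_add int[OF z])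
    also have "\<dots> = (LINT x:grid_cube h z|lborel. ?f x) + h ^ ?p * (2 * d)"
      by (simp only: set_integral_add(2)[OF int[OF z] const] LINT_const)
    finally show ?thesis .
  qed
  have "h ^ ?p * (\<Sum>z\<in>?Z. ?f (grid_corner h z))
      \<le> (\<Sum>z\<in>?Z. (LINT x:grid_cube h z|lborel. ?f x) + h ^ ?p * (2 * d))"
    unfolding sum_distrib_left by (intro sum_mono cube)
  also have "\<dots> = (\<Sum>z\<in>?Z. LINT x:grid_cube h z|lborel. ?f x) + card ?Z * h ^ ?p * (2 * d)"
    by (simp add: sum.distrib)
  also have "(\<Sum>z\<in>?Z. LINT x:grid_cube h z|lborel. ?f x) = (LINT x:(\<Union>z\<in>?Z. grid_cube h z)|lborel. ?f x)"
    using int Z(1) by (intro set_integral_finite_Union[symmetric])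
      (auto simp: disjoint_family_on_def disjoint_grid_cubes)
  also have "\<dots> \<le> (LINT x:A|lborel. ?f x)"
    using int_A unfolding set_lebesgue_integral_def set_integrable_def
    by (rule integral_mono') (auto simp: inner_cubes_def indicator_def)
  also have "\<dots> = mean_abs_proj ?p * measure lborel A"
    unfolding A_def by (rule LINT_shell_abs_sgn_inner[OF v]) auto
  also have "card ?Z * h ^ ?p * (2 * d) \<le> measure lborel A * (2 * d)"
    using Z(2) \<open>d \<ge> 0\<close> by (intro mult_right_mono) auto
  finally show ?thesis
    by (simp add: algebra_simps)
qed

section \<open>The upper bound\<close>

text \<open>With cubes of volume \<open>V / n\<close> at most \<open>n\<close> of them fit into the shell. The configuration consists of
  the directions of their corners, and of an arbitrary unit vector in place of each missing cube.
  A missing cube costs at most 1, and the missing cubes have a total volume of order \<open>d\<close>, so both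
  the padding and the Riemann sum contribute an error of order \<open>d\<close> per point.\<close>

lemma min_energy_le_mean_plus_mesh:
  fixes h :: real
  defines "d \<equiv> CARD('n::finite) * h"
  defines "V \<equiv> measure lborel (shell 1 2 :: (real ^ 'n) set)"
  assumes "h > 0" and h: "h ^ CARD('n) * real n = V"
  shows "min_energy n TYPE('n)
    \<le> real n * (mean_abs_proj CARD('n) + (2 + 2 * unit_ball_vol CARD('n) * CARD('n) * 2 ^ CARD('n) / V) * d)"
proof -
  let ?p = "CARD('n)"
  define K where "K = 2 * unit_ball_vol ?p * ?p * 2 ^ ?p"
  define m where "m = mean_abs_proj ?p"
  have "d > 0"
    using \<open>h > 0\<close> by (simp add: d_def)
  have "(1::real) < 2 ^ ?p"
    by (rule one_less_power) auto
  then have "V > 0"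
    by (simp add: V_def measure_shell)
  have "K \<ge> 0" "m \<ge> 0"
    by (simp_all add: K_def m_def mean_abs_proj_nonneg)
  have norm_axis': "axis undefined 1 \<in> sphere (0 :: real ^ 'n) 1"
    by simp
  have min_le: "min_energy n TYPE('n) \<le> B"
    if u: "u \<in> {..<n} \<rightarrow> sphere 0 1" and B: "\<And>v. norm v = 1 \<Longrightarrow> (\<Sum>i<n. \<bar>u i \<bullet> v\<bar>) \<le> B"
    for u :: "nat \<Rightarrow> real ^ 'n" and B
  proof -
    have "min_energy n TYPE('n) \<le> energy n u"
      using min_energy_attained u by metis
    also obtain v where "v \<in> sphere 0 1" "energy n u = (\<Sum>i<n. \<bar>u i \<bullet> v\<bar>)"
      using energy_attained by metis
    then have "energy n u \<le> B"
      using B by simp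
    finally show ?thesis .
  qed
  have "min_energy n TYPE('n) \<le> real n * (m + (2 + K / V) * d)"
  proof (cases "d \<le> 1/2")
    case False
    \<comment> \<open>For a coarse grid the claim is weaker than the trivial bound \<open>n\<close>.\<close>
    have "min_energy n TYPE('n) \<le> real n * 1"
    proof (rule min_le)
      fix v :: "real ^ 'n" assume v: "norm v = 1"
      have "(\<Sum>i<n. \<bar>axis undefined 1 \<bullet> v\<bar>) \<le> (\<Sum>i<n. (1::real))"
        using Cauchy_Schwarz_ineq2[of "axis undefined 1" v] v by (intro sum_mono) simp
      then show "(\<Sum>i<n. \<bar>axis undefined 1 \<bullet> v\<bar>) \<le> real n * 1"
        by simp
    qed auto
    also have "\<dots> \<le> real n * (m + (2 + K / V) * d)"
    proof (rule mult_left_mono)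
      have "1 \<le> 2 * d" "0 \<le> K / V * d"
        using False \<open>d > 0\<close> \<open>K \<ge> 0\<close> \<open>V > 0\<close> by auto
      then show "1 \<le> m + (2 + K / V) * d"
        using \<open>m \<ge> 0\<close> by (simp add: algebra_simps)
    qed simp
    finally show ?thesis .
  next
    case True
    let ?A = "shell 1 2 :: (real ^ 'n) set"
    define Z where "Z = inner_cubes h ?A"
    have Z: "finite Z" "card Z * h ^ ?p \<le> V"
      unfolding Z_def V_def using \<open>h > 0\<close>
      by (intro finite_card_inner_cubes emeasure_shell_finite; simp)+
    have defect: "V - card Z * h ^ ?p \<le> K * d"
      using card_inner_cubes_shell_ge[where 'n='n, OF \<open>h > 0\<close>] True
      by (simp add: K_def d_def V_def Z_def)
    have "real (card Z) * h ^ ?p \<le> real n * h ^ ?p"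
      using Z(2) h by (simp add: mult.commute)
    then have card_le: "card Z \<le> n"
      using \<open>h > 0\<close> by simp
    obtain e where e: "bij_betw e {..<card Z} Z"
      using ex_bij_betw_nat_finite[OF Z(1)] by (auto simp: atLeast0LessThan)
    define u where "u i = (if i < card Z then sgn (grid_corner h (e i)) else axis undefined 1)" for i
    have corner: "norm (sgn (grid_corner h z)) = 1" if "z \<in> Z" for z
    proof -
      have "grid_corner h z \<in> ?A"
        using that grid_corner_in_cube[OF \<open>h > 0\<close>, of z] by (auto simp: Z_def inner_cubes_def)
      then show ?thesis
        by (auto simp: norm_sgn)
    qed
    have u: "u \<in> {..<n} \<rightarrow> sphere 0 1"
      using corner bij_betwE[OF e] by (auto simp: u_def)
    show ?thesis
    proof (rule min_le[OF u])
      fix v :: "real ^ 'n" assume v: "norm v = 1"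
      have "(\<Sum>i<n. \<bar>u i \<bullet> v\<bar>) = (\<Sum>i<card Z. \<bar>u i \<bullet> v\<bar>) + (\<Sum>i=card Z..<n. \<bar>u i \<bullet> v\<bar>)"
        using card_le sum.atLeastLessThan_concat[of 0 "card Z" n "\<lambda>i. \<bar>u i \<bullet> v\<bar>"]
        by (simp add: atLeast0LessThan)
      also have "(\<Sum>i<card Z. \<bar>u i \<bullet> v\<bar>) = (\<Sum>z\<in>Z. \<bar>sgn (grid_corner h z) \<bullet> v\<bar>)"
        by (subst sum.reindex_bij_betw[OF e, symmetric]) (simp add: u_def)
      also have "(\<Sum>i=card Z..<n. \<bar>u i \<bullet> v\<bar>) \<le> (\<Sum>i=card Z..<n. 1)"
      proof (rule sum_mono)
        fix i assume "i \<in> {card Z..<n}"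
        then have "norm (u i) = 1"
          using u by (auto simp: Pi_iff)
        then show "\<bar>u i \<bullet> v\<bar> \<le> 1"
          using Cauchy_Schwarz_ineq2[of "u i" v] v by simp
      qed
      also have "(\<Sum>i=card Z..<n. 1) = real n - real (card Z)"
        using card_le by (simp add: of_nat_diff)
      finally have "h ^ ?p * (\<Sum>i<n. \<bar>u i \<bullet> v\<bar>)
          \<le> h ^ ?p * ((\<Sum>z\<in>Z. \<bar>sgn (grid_corner h z) \<bullet> v\<bar>) + (real n - real (card Z)))"
        using \<open>h > 0\<close> by simp
      also have "\<dots> = h ^ ?p * (\<Sum>z\<in>Z. \<bar>sgn (grid_corner h z) \<bullet> v\<bar>) + (V - card Z * h ^ ?p)"
        using h by (simp add: algebra_simps)
      also have "\<dots> \<le> (m + 2 * d) * V + K * d"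
        using sum_inner_cubes_le[OF \<open>h > 0\<close> v] defect by (simp add: m_def d_def V_def Z_def)
      also have "\<dots> = h ^ ?p * (real n * (m + (2 + K / V) * d))"
        using \<open>V > 0\<close> unfolding mult.assoc[symmetric] h by (simp add: algebra_simps)
      finally show "(\<Sum>i<n. \<bar>u i \<bullet> v\<bar>) \<le> real n * (m + (2 + K / V) * d)"
        using \<open>h > 0\<close> by simp
    qed
  qed
  then show ?thesis
    by (simp add: K_def m_def)
qed

theorem theorem3p3:
  shows "\<exists>C::real. \<forall>n::nat. n > CARD('p::finite) \<longrightarrow>
    Gamma (real CARD('p) / 2) / (sqrt pi * Gamma ((real CARD('p) + 1) / 2))
      \<le> min_energy n TYPE('p) / real n \<and>
    min_energy n TYPE('p) / real n
      \<le> Gamma (real CARD('p) / 2) / (sqrt pi * Gamma ((real CARD('p) + 1) / 2))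
        + C * real n powr (- 1 / real CARD('p))"
proof -
  let ?p = "real CARD('p)"
  define V where "V = measure lborel (shell 1 2 :: (real ^ 'p) set)"
  define K where "K = 2 + 2 * unit_ball_vol ?p * ?p * 2 ^ CARD('p) / V"
  have "(1::real) < 2 ^ CARD('p)"
    by (rule one_less_power) auto
  then have "V > 0"
    by (simp add: V_def measure_shell)
  have "mean_abs_proj ?p \<le> min_energy n TYPE('p) / real n"
    and "min_energy n TYPE('p) / real n
      \<le> mean_abs_proj ?p + (K * ?p * V powr (1 / ?p)) * real n powr (- 1 / ?p)"
    if "n > CARD('p)" for n
  proof -
    have n: "real n > 0"
      using that by simp
    obtain u :: "nat \<Rightarrow> real ^ 'p" where u: "u \<in> {..<n} \<rightarrow> sphere 0 1" "energy n u = min_energy n TYPE('p)"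
      using min_energy_attained by metis
    show "mean_abs_proj ?p \<le> min_energy n TYPE('p) / real n"
      using mean_abs_proj_le_energy[OF u(1)] n by (simp add: u(2) field_simps)
    define h where "h = V powr (1 / ?p) * real n powr (- 1 / ?p)"
    have "h > 0"
      using n \<open>V > 0\<close> by (simp add: h_def)
    have root_power: "(x powr (1 / ?p)) ^ CARD('p) = x" if "x > 0" for x
      using that by (simp add: powr_power)
    have "real n powr (- 1 / ?p) = inverse (real n powr (1 / ?p))"
      by (simp add: powr_minus[symmetric])
    then have "h ^ CARD('p) = V * inverse (real n)"
      using n \<open>V > 0\<close> by (simp only: h_def power_mult_distrib power_inverse root_power)
    then have "h ^ CARD('p) * real n = V"
      using n by simp
    from min_energy_le_mean_plus_mesh[OF \<open>h > 0\<close> this[unfolded V_def]]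
    have "min_energy n TYPE('p) \<le> real n * (mean_abs_proj ?p + K * (?p * h))"
      by (simp add: K_def V_def)
    then show "min_energy n TYPE('p) / real n
      \<le> mean_abs_proj ?p + (K * ?p * V powr (1 / ?p)) * real n powr (- 1 / ?p)"
      using n by (simp add: h_def field_simps)
  qed
  then show ?thesis
    unfolding mean_abs_proj_def by blast
qed

end
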